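(* Let $X$ be a proper complete CAT(0) space and let $\zeta$ be a point in the Morse boundary of $X$. If $h_\zeta$ is a horofunction corresponding to $\zeta$, then any sequence of $h_\zeta$-horospheres must converge to $\zeta$.
   Context: $\partial X$ is the visual (CAT(0)) boundary of $X$: equivalence classes of asymptotic geodesic rays; convergence of points of $X$ to points of $\partial X$ is in $X\cup\partial X$ with the cone topology. A geodesic ray $c$ is Morse if there is a function $N:[1,\infty)\times[0,\infty)\to[0,\infty)$ such that every $(\lambda,\epsilon)$-quasi-geodesic with endpoints on $c$ lies in the $N(\lambda,\epsilon)$-neighborhood of $c$; a point of $\partial X$ is in the Morse boundary if it is represented by a Morse ray. A continuous map $h:X\to\mathbb{R}$ is distance-like if whenever $h(x)\ge\lambda$ for some $\lambda\in\mathbb{R}$, the set $h^{-1}(\lambda)$ is nonempty and $h(x)=\lambda+d(x,h^{-1}(\lambda))$. A horofunction is a convex distance-like function. The Busemann function of a geodesic ray $c$ is $b_c(x)=\lim_{t\to\infty}[d(x,c(t))-t]$. Every horofunction is of the form $b_c+C$ with $c$ a geodesic ray and $C\in\mathbb{R}$; it corresponds to $\zeta\in\partial X$ if $c$ represents $\zeta$. For a horofunction $h$ and $r\in\mathbb{R}$, the $r$-horosphere of $h$ is $H_r=h^{-1}(-r)$; a horosphere of $h$ (an $h$-horosphere) is an $r$-horosphere of $h$ for some $r$. Let $h$ be a horofunction corresponding to $\zeta\in\partial X$. A sequence $\{H_n\}_{n\in\mathbb{N}}$ of horospheres of $h$ converges to $\zeta$ if for any sequence $\{x_n\}_{n\in\mathbb{N}}$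 with $x_n\in H_n$ such that $x_n\to\eta\in\partial X$, we have $\eta=\zeta$.
   Formalization: The sequence of horospheres h^{-1}(-r_n) is assumed to have levels r_n not tending to -∞; without this the claim fails, e.g. X = ℝ, h(x) = -x, ζ = +∞, horospheres {-n}. *)

theory Defs
  imports "HOL-Analysis.Analysis"
begin

text \<open>The ambient space \<open>X\<close> is the whole type \<open>'a\<close>.\<close>

definition proper_space :: "'a::metric_space itself \<Rightarrow> bool" where
  "proper_space _ \<longleftrightarrow> (\<forall>(x::'a) r. compact (cball x r))"


section \<open>Geodesics and CAT(0) spaces\<close>

definition geodesic_path :: "(real \<Rightarrow> 'a::metric_space) \<Rightarrow> real \<Rightarrow> 'a \<Rightarrow> 'a \<Rightarrow> bool" where
  "geodesic_path g l p q \<longleftrightarrow>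
     0 \<le> l \<and> g 0 = p \<and> g l = q \<and> (\<forall>s\<in>{0..l}. \<forall>t\<in>{0..l}. dist (g s) (g t) = \<bar>s - t\<bar>)"

definition geodesic_segment :: "'a::metric_space set \<Rightarrow> 'a \<Rightarrow> 'a \<Rightarrow> bool" where
  "geodesic_segment S p q \<longleftrightarrow> (\<exists>g l. geodesic_path g l p q \<and> S = g ` {0..l})"

definition geodesic_space :: "'a::metric_space itself \<Rightarrow> bool" where
  "geodesic_space _ \<longleftrightarrow> (\<forall>p q :: 'a. \<exists>S. geodesic_segment S p q)"

text \<open>
  In the CAT(0) inequality the points \<open>x\<close>, \<open>y\<close> lie on the two sides of the geodesic triangle
  issuing from \<open>p\<close>. As \<open>p\<close>, \<open>q\<close>, \<open>r\<close> are arbitrary and any two distinct sides of a triangle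
  share a vertex, this covers all pairs of sides; for two points on the same side the
  inequality is an equality.
\<close>

definition CAT0_space :: "'a::metric_space itself \<Rightarrow> bool" where
  "CAT0_space T \<longleftrightarrow> geodesic_space T \<and>
     (\<forall>(p::'a) q r S S' (p' :: real^2) q' r'.
        geodesic_segment S p q \<and> geodesic_segment S' p r \<and>
        dist p' q' = dist p q \<and> dist p' r' = dist p r \<and> dist q' r' = dist q r \<longrightarrow>
        (\<forall>x\<in>S. \<forall>y\<in>S'. \<forall>x'\<in>closed_segment p' q'. \<forall>y'\<in>closed_segment p' r'.
           dist p' x' = dist p x \<and> dist p' y' = dist p y \<longrightarrow> dist x y \<le> dist x' y'))"


section \<open>The visual boundary and the cone topology\<close>

text \<open>Rays are total functions on \<open>real\<close>; their values at negative arguments are irrelevant.\<close>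

definition geodesic_ray :: "(real \<Rightarrow> 'a::metric_space) \<Rightarrow> bool" where
  "geodesic_ray c \<longleftrightarrow> (\<forall>s\<ge>0. \<forall>t\<ge>0. dist (c s) (c t) = \<bar>s - t\<bar>)"

definition asymptotic_rel :: "((real \<Rightarrow> 'a::metric_space) \<times> (real \<Rightarrow> 'a)) set" where
  "asymptotic_rel =
     {(c, c'). geodesic_ray c \<and> geodesic_ray c' \<and> (\<exists>K. \<forall>t\<ge>0. dist (c t) (c' t) \<le> K)}"

definition visual_boundary :: "(real \<Rightarrow> 'a::metric_space) set set" where
  "visual_boundary = {c. geodesic_ray c} // asymptotic_rel"

text \<open>
  Points of \<open>X \<union> \<partial>X\<close> are encoded in a sum type. The set \<open>cone_nbhd c r e\<close> consists of the points
  \<open>x\<close> of \<open>X \<union> \<partial>X\<close> at distance more than \<open>r\<close> from \<open>c 0\<close> such that the geodesic (segment or ray)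
  from \<open>c 0\<close> to \<open>x\<close>, which in a complete CAT(0) space exists and is unique, passes within
  distance \<open>e\<close> of \<open>c r\<close> at time \<open>r\<close>. Rays \<open>c\<close> with arbitrary origin are used to generate the
  cone topology, which is harmless because in a complete CAT(0) space it does not depend on
  the choice of a base point.
\<close>

definition cone_nbhd ::
  "(real \<Rightarrow> 'a::metric_space) \<Rightarrow> real \<Rightarrow> real \<Rightarrow> ('a + (real \<Rightarrow> 'a) set) set" where
  "cone_nbhd c r e =
     Inl ` {x. r < dist (c 0) x \<and>
               (\<exists>g. geodesic_path g (dist (c 0) x) (c 0) x \<and> dist (g r) (c r) < e)} \<union>
     Inr ` {\<xi> \<in> visual_boundary. \<exists>c'\<in>\<xi>. c' 0 = c 0 \<and> dist (c' r) (c r) < e}"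

definition cone_topology :: "('a::metric_space + (real \<Rightarrow> 'a) set) topology" where
  "cone_topology = topology_generated_by
     ({Inl ` ball x r |x r. 0 < r} \<union>
      {cone_nbhd c r e |c r e. geodesic_ray c \<and> 0 < r \<and> 0 < e})"


section \<open>The Morse boundary\<close>

definition quasi_geodesic ::
  "real \<Rightarrow> real \<Rightarrow> (real \<Rightarrow> 'a::metric_space) \<Rightarrow> real \<Rightarrow> real \<Rightarrow> bool" where
  "quasi_geodesic l e q a b \<longleftrightarrow>
     (\<forall>s\<in>{a..b}. \<forall>t\<in>{a..b}.
        \<bar>s - t\<bar> / l - e \<le> dist (q s) (q t) \<and> dist (q s) (q t) \<le> l * \<bar>s - t\<bar> + e)"

definition Morse_ray :: "(real \<Rightarrow> 'a::metric_space) \<Rightarrow> bool" where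
  "Morse_ray c \<longleftrightarrow> geodesic_ray c \<and>
     (\<exists>N :: real \<Rightarrow> real \<Rightarrow> real. \<forall>l\<ge>1. \<forall>e\<ge>0. 0 \<le> N l e \<and>
        (\<forall>q a b. a \<le> b \<and> quasi_geodesic l e q a b \<and> q a \<in> c ` {0..} \<and> q b \<in> c ` {0..} \<longrightarrow>
           (\<forall>t\<in>{a..b}. infdist (q t) (c ` {0..}) \<le> N l e)))"

definition Morse_boundary :: "(real \<Rightarrow> 'a::metric_space) set set" where
  "Morse_boundary = {\<zeta> \<in> visual_boundary. \<exists>c\<in>\<zeta>. Morse_ray c}"


section \<open>Horofunctions and horospheres\<close>

definition distance_like :: "('a::metric_space \<Rightarrow> real) \<Rightarrow> bool" where
  "distance_like h \<longleftrightarrow> continuous_on UNIV h \<and>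
     (\<forall>x l. l \<le> h x \<longrightarrow> h -` {l} \<noteq> {} \<and> h x = l + infdist x (h -` {l}))"

definition geodesically_convex :: "('a::metric_space \<Rightarrow> real) \<Rightarrow> bool" where
  "geodesically_convex h \<longleftrightarrow>
     (\<forall>g l p q. geodesic_path g l p q \<longrightarrow> convex_on {0..l} (\<lambda>t. h (g t)))"

definition horofunction :: "('a::metric_space \<Rightarrow> real) \<Rightarrow> bool" where
  "horofunction h \<longleftrightarrow> geodesically_convex h \<and> distance_like h"

definition busemann :: "(real \<Rightarrow> 'a::metric_space) \<Rightarrow> 'a \<Rightarrow> real" where
  "busemann c x = Lim at_top (\<lambda>t. dist x (c t) - t)"

definition corresponds_to ::
  "('a::metric_space \<Rightarrow> real) \<Rightarrow> (real \<Rightarrow> 'a) set \<Rightarrow> bool" where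
  "corresponds_to h \<zeta> \<longleftrightarrow> (\<exists>c C. geodesic_ray c \<and> c \<in> \<zeta> \<and> (\<forall>x. h x = busemann c x + C))"

definition horosphere :: "('a \<Rightarrow> real) \<Rightarrow> real \<Rightarrow> 'a set" where
  "horosphere h r = h -` {- r}"

text \<open>
  Pitfall: horospheres \<open>horosphere h (r n)\<close> with \<open>r n\<close> tending to \<open>-\<infinity>\<close> recede from the centre of \<open>h\<close>
  and in general do not converge to it. On the real line \<open>h x = - x\<close> is a horofunction
  corresponding to the (Morse) end \<open>+\<infinity>\<close>, and \<open>horosphere h (- n) = {- n}\<close>, which tends to the
  other end.
\<close>

definition horospheres_converge ::
  "(nat \<Rightarrow> 'a::metric_space set) \<Rightarrow> (real \<Rightarrow> 'a) set \<Rightarrow> bool" where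
  "horospheres_converge H \<zeta> \<longleftrightarrow>
     (\<forall>x. \<forall>\<eta>\<in>visual_boundary.
        (\<forall>n. x n \<in> H n) \<and> limitin cone_topology (\<lambda>n. Inl (x n)) (Inr \<eta>) sequentially \<longrightarrow>
        \<eta> = \<zeta>)"

end

theory Submission imports Defs begin

text \<open>
  Since the levels do not tend to \<open>-\<infinity>\<close>, the horofunction is at most some constant at infinitely
  many \<open>x n\<close>. By convexity it is bounded above on the geodesics from a base point to these \<open>x n\<close>,
  hence on the limiting ray to \<open>\<eta>\<close>. A ray in a horoball centred at the endpoint of a Morse ray
  must be asymptotic to that Morse ray.
\<close>

section \<open>CAT(0) inequalities from comparison triangles\<close>

text \<open>For \<open>a > 0\<close> the vertices are the origin, \<open>(a, 0)\<close> and
  \<open>(u, w)\<close>, with \<open>u\<close> dictated by the law of cosines. The triangle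
  inequalities give \<open>\<bar>u\<bar> \<le> b\<close>, which makes \<open>w\<close> real.\<close>

lemma comparison_triangle:
  fixes a b c :: real
  assumes "0 \<le> a" "0 \<le> b" "a \<le> b + c" "b \<le> a + c" "c \<le> a + b"
  obtains p q r :: "real^2" where "dist p q = a" "dist p r = b" "dist q r = c"
proof (cases "a = 0")
  case True
  then have "c = b" using assms by linarith
  then have "dist (0::real^2) 0 = a" "dist 0 (vector [b, 0] :: real^2) = b"
    "dist 0 (vector [b, 0] :: real^2) = c"
    using True assms(2) by (simp_all add: dist_vec_def L2_set_def sum_2)
  then show ?thesis using that by blast
next
  case False
  then have a: "a > 0" using assms by simp
  define u where "u = (a\<^sup>2 + b\<^sup>2 - c\<^sup>2) / (2 * a)"
  have ua: "2 * a * u = a\<^sup>2 + b\<^sup>2 - c\<^sup>2" using a by (simp add: u_def)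
  have "c\<^sup>2 \<le> (a + b)\<^sup>2" using assms by (intro power_mono) auto
  then have "2 * a * u \<ge> 2 * a * (- b)" unfolding ua by (simp add: power2_sum)
  then have u1: "- b \<le> u" using a mult_le_cancel_left_pos[of "2 * a" "- b" u] by simp
  have "\<bar>a - b\<bar> \<le> \<bar>c\<bar>" using assms by linarith
  then have "(a - b)\<^sup>2 \<le> c\<^sup>2" by (simp add: abs_le_square_iff)
  then have "2 * a * u \<le> 2 * a * b" unfolding ua by (simp add: power2_diff)
  then have u2: "u \<le> b" using a by simp
  have "\<bar>u\<bar> \<le> \<bar>b\<bar>" using u1 u2 by linarith
  then have ub: "u\<^sup>2 \<le> b\<^sup>2" by (simp add: abs_le_square_iff)
  define w where "w = sqrt (b\<^sup>2 - u\<^sup>2)"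
  have w: "w\<^sup>2 = b\<^sup>2 - u\<^sup>2" using ub by (simp add: w_def)
  have "(a - u)\<^sup>2 + w\<^sup>2 = c\<^sup>2" using ua w by (simp add: power2_diff)
  then have "dist (0::real^2) (vector [a, 0]) = a" "dist 0 (vector [u, w] :: real^2) = b"
    "dist (vector [a, 0]) (vector [u, w] :: real^2) = c"
    using assms w by (simp_all add: dist_vec_def L2_set_def sum_2 dist_real_def)
  then show ?thesis using that by blast
qed

text \<open>In the plane the parallelogram law makes this an equality for the median of the
  comparison triangle; a median in a CAT(0) space is no longer than its comparison median.\<close>

lemma CAT0_CN_inequality:
  fixes g :: "real \<Rightarrow> 'a::metric_space"
  assumes cat: "CAT0_space TYPE('a)" and g: "geodesic_path g l p q"
  shows "(dist (g (l / 2)) y)\<^sup>2 \<le> (dist p y)\<^sup>2 / 2 + (dist q y)\<^sup>2 / 2 - l\<^sup>2 / 4"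
proof -
  have l: "0 \<le> l" "g 0 = p" "g l = q"
    and iso: "\<And>s t. s \<in> {0..l} \<Longrightarrow> t \<in> {0..l} \<Longrightarrow> dist (g s) (g t) = \<bar>s - t\<bar>"
    using g by (auto simp: geodesic_path_def)
  have lpq: "dist p q = l" using iso[of 0 l] l by simp
  obtain p' q' r' :: "real^2"
    where tri: "dist p' q' = dist p q" "dist p' r' = dist p y" "dist q' r' = dist q y"
    by (rule comparison_triangle[of "dist p q" "dist p y" "dist q y"])
      (use dist_triangle3[of p q y] dist_triangle3[of p y q] dist_triangle3[of q y p]
       in \<open>auto simp: dist_commute\<close>)
  obtain S' where S': "geodesic_segment S' p y"
    using cat unfolding CAT0_space_def geodesic_space_def by blast
  then have y: "y \<in> S'" unfolding geodesic_segment_def geodesic_path_def by force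
  have S: "geodesic_segment (g ` {0..l}) p q" using g unfolding geodesic_segment_def by blast
  have m: "g (l / 2) \<in> g ` {0..l}" using l by simp
  \<comment> \<open>The opposite vertex \<open>y\<close> is treated as a point of the side from
    \<open>p\<close> to \<open>y\<close>, because \<open>CAT0_space\<close> compares points on two
    sides.\<close>
  have m': "midpoint p' q' \<in> closed_segment p' q'" "r' \<in> closed_segment p' r'" by auto
  have dm: "dist p' (midpoint p' q') = dist p (g (l / 2))"
    using iso[of 0 "l / 2"] l tri(1) lpq by (simp add: dist_midpoint)
  have le: "dist (g (l / 2)) y \<le> dist (midpoint p' q') r'"
    using cat S S' tri m y m' dm unfolding CAT0_space_def by metis
  have mid: "midpoint p' q' - r' = (1 / 2) *\<^sub>R ((p' - r') + (q' - r'))"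
    by (simp add: midpoint_def vec_eq_iff field_simps)
  have parallelogram: "(norm ((1 / 2) *\<^sub>R (v + w)))\<^sup>2
      = (norm v)\<^sup>2 / 2 + (norm w)\<^sup>2 / 2 - (norm (v - w))\<^sup>2 / 4" for v w :: "real^2"
    by (simp only: power2_norm_eq_inner)
      (simp add: inner_commute algebra_simps add_divide_distrib diff_divide_distrib)
  have pq: "p' - q' = (p' - r') - (q' - r')" by simp
  have "(dist (midpoint p' q') r')\<^sup>2
      = (dist p' r')\<^sup>2 / 2 + (dist q' r')\<^sup>2 / 2 - (dist p' q')\<^sup>2 / 4"
    unfolding dist_norm mid pq by (rule parallelogram)
  moreover have "(dist (g (l / 2)) y)\<^sup>2 \<le> (dist (midpoint p' q') r')\<^sup>2"
    using le by (intro power_mono) auto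
  ultimately show ?thesis using tri lpq by simp
qed

text \<open>A weak Pythagoras theorem at a nearest point. Testing minimality at the midpoint alone
  costs a factor 1/2 on the square of \<open>l\<close>, which is harmless later.\<close>

lemma CAT0_projection:
  fixes g :: "real \<Rightarrow> 'a::metric_space"
  assumes cat: "CAT0_space TYPE('a)" and g: "geodesic_path g l p q"
    and near: "\<And>t. t \<in> {0..l} \<Longrightarrow> dist p y \<le> dist (g t) y"
  shows "(dist p y)\<^sup>2 + l\<^sup>2 / 2 \<le> (dist q y)\<^sup>2"
proof -
  have "0 \<le> l" using g by (simp add: geodesic_path_def)
  then have "(dist p y)\<^sup>2 \<le> (dist (g (l / 2)) y)\<^sup>2" using near[of "l / 2"] by (intro power_mono) auto
  then show ?thesis using CAT0_CN_inequality[OF cat g, of y] by linarith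
qed

section \<open>Geodesics ending at a projection and the Morse property\<close>

text \<open>Since \<open>z\<close> is nearest to \<open>y\<close>, the path cannot backtrack much at
  the corner \<open>z\<close>, and triangle inequalities give the factor 3. The jump from
  \<open>w\<close> to \<open>p\<close> and the unit of time spent at \<open>w\<close> are absorbed
  by the additive constant.\<close>

lemma geodesic_to_projection_quasi_geodesic:
  fixes g :: "real \<Rightarrow> 'a::metric_space"
  assumes g: "geodesic_path g l p z" and k: "geodesic_path k m z y"
    and near: "\<And>t. t \<in> {0..l} \<Longrightarrow> dist z y \<le> dist (g t) y"
    and d: "dist w p \<le> \<delta>"
  shows "quasi_geodesic 3 (\<delta> + 1)
    (\<lambda>t. if t < 0 then w else if t \<le> l then g t else k (t - l)) (- 1) (l + m)"
proof -
  define q where "q = (\<lambda>t. if t \<le> l then g t else k (t - l))"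
  define q' where "q' = (\<lambda>t. if t < 0 then w else q t)"
  have l: "0 \<le> l" "g 0 = p" "g l = z"
    and isog: "\<And>s t. s \<in> {0..l} \<Longrightarrow> t \<in> {0..l} \<Longrightarrow> dist (g s) (g t) = \<bar>s - t\<bar>"
    using g by (auto simp: geodesic_path_def)
  have m: "0 \<le> m" "k 0 = z" "k m = y"
    and isok: "\<And>s t. s \<in> {0..m} \<Longrightarrow> t \<in> {0..m} \<Longrightarrow> dist (k s) (k t) = \<bar>s - t\<bar>"
    using k by (auto simp: geodesic_path_def)
  have \<delta>: "0 \<le> \<delta>" using d zero_le_dist order_trans by blast
  have upper_lower: "dist (q s) (q t) \<le> t - s \<and> t - s \<le> 3 * dist (q s) (q t)"
    if st: "0 \<le> s" "s \<le> t" "t \<le> l + m" for s t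
  proof -
    consider "t \<le> l" | "s \<le> l" "l < t" | "l < s" using st by linarith
    then show ?thesis
    proof cases
      case 1
      then show ?thesis using isog[of s t] st by (simp add: q_def)
    next
      case 2
      have e1: "dist (g s) z = l - s" using isog[of s l] st 2 l by simp
      have e2: "dist z (k (t - l)) = t - l" using isok[of 0 "t - l"] st 2 m by simp
      have e3: "dist (k (t - l)) y = m - (t - l)" using isok[of "t - l" m] st 2 m by simp
      have e4: "dist z y = m" using isok[of 0 m] m by simp
      have "m \<le> dist (g s) y" using near[of s] st 2 e4 by simp
      also have "\<dots> \<le> dist (g s) (k (t - l)) + (m - (t - l))"
        using dist_triangle[of "g s" y "k (t - l)"] e3 by simp
      finally have a: "t - l \<le> dist (g s) (k (t - l))" by simp
      have b: "l - s \<le> dist (g s) (k (t - l)) + (t - l)"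
        using dist_triangle[of "g s" z "k (t - l)"] e1 e2 by (simp add: dist_commute)
      have c: "dist (g s) (k (t - l)) \<le> t - s"
        using dist_triangle[of "g s" "k (t - l)" z] e1 e2 by simp
      \<comment> \<open>The factor 3: \<open>t - s\<close> is \<open>(l - s) + (t - l)\<close>, at
        most the distance plus \<open>2 * (t - l)\<close> by \<open>b\<close>, hence at most three
        times the distance by \<open>a\<close>.\<close>
      show ?thesis using a b c 2 by (simp add: q_def)
    next
      case 3
      then show ?thesis using isok[of "s - l" "t - l"] st by (simp add: q_def)
    qed
  qed
  have q0: "q 0 = p" using l by (simp add: q_def)
  have main: "(t - s) / 3 - (\<delta> + 1) \<le> dist (q' s) (q' t) \<and> dist (q' s) (q' t) \<le> 3 * (t - s) + (\<delta> + 1)"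
    if st: "- 1 \<le> s" "s \<le> t" "t \<le> l + m" for s t
  proof -
    consider "0 \<le> s" | "s < 0" "0 \<le> t" | "t < 0" by linarith
    then show ?thesis
    proof cases
      case 1
      then have "q' s = q s" "q' t = q t" using st by (simp_all add: q'_def)
      moreover have "dist (q s) (q t) \<le> t - s" "t - s \<le> 3 * dist (q s) (q t)"
        using upper_lower[of s t] 1 st by auto
      ultimately show ?thesis using st \<delta> by (simp add: field_simps)
    next
      case 2
      have "dist w (q t) \<le> dist w p + dist p (q t)" "dist p (q t) \<le> dist w p + dist w (q t)"
        using dist_triangle dist_triangle3[of p "q t" w] by auto
      moreover have "dist p (q t) \<le> t" "t \<le> 3 * dist p (q t)"
        using upper_lower[of 0 t] q0 st 2 by auto
      moreover have "q' s = w" "q' t = q t" using 2 by (simp_all add: q'_def)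
      ultimately show ?thesis using st 2 d by (simp add: field_simps)
    next
      case 3
      then show ?thesis using st \<delta> by (simp add: q'_def)
    qed
  qed
  have "quasi_geodesic 3 (\<delta> + 1) q' (- 1) (l + m)"
    unfolding quasi_geodesic_def
  proof (intro ballI)
    fix s t assume "s \<in> {- 1..l + m}" "t \<in> {- 1..l + m}"
    then show "\<bar>s - t\<bar> / 3 - (\<delta> + 1) \<le> dist (q' s) (q' t) \<and> dist (q' s) (q' t) \<le> 3 * \<bar>s - t\<bar> + (\<delta> + 1)"
      using main[of s t] main[of t s] by (cases "s \<le> t") (auto simp: dist_commute abs_if)
  qed
  then show ?thesis unfolding q'_def q_def .
qed

text \<open>The witness is the geodesic to \<open>z\<close> followed by one from \<open>z\<close> to the point \<open>c v\<close> projecting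
  to \<open>z\<close>; a jump from \<open>c u\<close> is put in front, since the Morse property needs both endpoints on \<open>c\<close>.\<close>

lemma Morse_projection:
  fixes c :: "real \<Rightarrow> 'a::metric_space"
  assumes geo: "geodesic_space TYPE('a)" and c: "Morse_ray c" and "0 \<le> \<delta>"
  obtains N where "0 \<le> N"
    "\<And>g l p z u v t. \<lbrakk>geodesic_path g l p z; 0 \<le> u; dist (c u) p \<le> \<delta>; 0 \<le> v;
      \<And>s. s \<in> {0..l} \<Longrightarrow> dist z (c v) \<le> dist (g s) (c v); t \<in> {0..l}\<rbrakk>
      \<Longrightarrow> \<exists>w\<ge>0. dist (g t) (c w) \<le> N"
proof -
  from c obtain N :: "real \<Rightarrow> real \<Rightarrow> real" where N: "\<And>l e. 1 \<le> l \<Longrightarrow> 0 \<le> e \<Longrightarrow> 0 \<le> N l e"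
    "\<And>l e q a b t. \<lbrakk>1 \<le> l; 0 \<le> e; a \<le> b; quasi_geodesic l e q a b; q a \<in> c ` {0..};
      q b \<in> c ` {0..}; t \<in> {a..b}\<rbrakk> \<Longrightarrow> infdist (q t) (c ` {0..}) \<le> N l e"
    unfolding Morse_ray_def by metis
  let ?N = "N 3 (\<delta> + 1)"
  have N0: "0 \<le> ?N" using N(1) assms(3) by simp
  have "\<exists>w\<ge>0. dist (g t) (c w) \<le> ?N + 1"
    if g: "geodesic_path g l p z" and u: "0 \<le> u" "dist (c u) p \<le> \<delta>" and v: "0 \<le> v"
      and near: "\<And>s. s \<in> {0..l} \<Longrightarrow> dist z (c v) \<le> dist (g s) (c v)" and t: "t \<in> {0..l}"
    for g l p z u v t
  proof -
    obtain k m where k: "geodesic_path k m z (c v)"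
      using geo unfolding geodesic_space_def geodesic_segment_def by blast
    let ?q = "\<lambda>t. if t < 0 then c u else if t \<le> l then g t else k (t - l)"
    have lm: "0 \<le> l" "0 \<le> m" "g l = z" "k 0 = z" "k m = c v"
      using g k by (auto simp: geodesic_path_def)
    have "quasi_geodesic 3 (\<delta> + 1) ?q (- 1) (l + m)"
      using g k near u(2) by (rule geodesic_to_projection_quasi_geodesic)
    \<comment> \<open>If \<open>m = 0\<close>, the end parameter falls in the branch of
      \<open>g\<close>, whose endpoint \<open>z\<close> is then \<open>c v\<close>.\<close>
    moreover have "?q (l + m) = c v" using lm by (cases "m = 0") auto
    then have "?q (l + m) \<in> c ` {0..}" using v by auto
    moreover have "?q (- 1) \<in> c ` {0..}" using u by auto
    ultimately have "infdist (?q t) (c ` {0..}) \<le> ?N"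
      using t lm assms(3) by (intro N(2)[of _ _ "- 1" "l + m"]) auto
    \<comment> \<open>The extra 1 yields an actual point of \<open>c\<close> without attaining the
      infimum.\<close>
    then have "infdist (g t) (c ` {0..}) < ?N + 1" using t by simp
    then have "\<exists>a\<in>c ` {0..}. dist (g t) a < ?N + 1"
      by (auto simp: infdist_notempty dest!: cInf_lessD[rotated])
    then show ?thesis using less_imp_le by blast
  qed
  then show ?thesis using N0 that[of "?N + 1"] by simp
qed

section \<open>The visual boundary as a quotient\<close>

lemma equiv_asymptotic_rel:
  "equiv {c :: real \<Rightarrow> 'a::metric_space. geodesic_ray c} asymptotic_rel"
proof (rule equivI)
  show "asymptotic_rel \<subseteq> {c. geodesic_ray c} \<times> {c. geodesic_ray c}"
    by (auto simp: asymptotic_rel_def)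
  show "refl_on {c. geodesic_ray c} asymptotic_rel"
    by (auto simp: refl_on_def asymptotic_rel_def intro!: exI[of _ 0])
  show "sym asymptotic_rel"
    by (auto simp: sym_def asymptotic_rel_def dist_commute)
  show "trans (asymptotic_rel :: ((real \<Rightarrow> 'a) \<times> (real \<Rightarrow> 'a)) set)"
  proof (rule transI)
    fix c c' c'' :: "real \<Rightarrow> 'a"
    assume "(c, c') \<in> asymptotic_rel" "(c', c'') \<in> asymptotic_rel"
    then obtain K K' where "geodesic_ray c" "geodesic_ray c''"
      "\<And>t. 0 \<le> t \<Longrightarrow> dist (c t) (c' t) \<le> K" "\<And>t. 0 \<le> t \<Longrightarrow> dist (c' t) (c'' t) \<le> K'"
      unfolding asymptotic_rel_def by auto
    moreover from this have "dist (c t) (c'' t) \<le> K + K'" if "0 \<le> t" for t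
      using that dist_triangle[of "c t" "c'' t" "c' t"] by (meson add_mono order_trans)
    ultimately show "(c, c'') \<in> asymptotic_rel" unfolding asymptotic_rel_def by blast
  qed
qed

lemma visual_boundary_eqI:
  assumes "\<eta> \<in> visual_boundary" "\<zeta> \<in> visual_boundary" "c \<in> \<eta>" "c' \<in> \<zeta>" "(c, c') \<in> asymptotic_rel"
  shows "\<eta> = \<zeta>"
  using assms quotient_eq_iff[OF equiv_asymptotic_rel] unfolding visual_boundary_def by blast

lemma visual_boundary_rayD:
  assumes "\<zeta> \<in> visual_boundary" "c \<in> \<zeta>"
  shows "geodesic_ray c"
  using assms in_quotient_imp_subset[OF equiv_asymptotic_rel] unfolding visual_boundary_def by blast

lemma visual_boundary_asymptotic:
  assumes "\<zeta> \<in> visual_boundary" "c \<in> \<zeta>" "c' \<in> \<zeta>"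
  shows "(c, c') \<in> asymptotic_rel"
  using assms in_quotient_imp_in_rel[OF equiv_asymptotic_rel] unfolding visual_boundary_def by blast

section \<open>Busemann limits and nearest points on geodesics\<close>

text \<open>\<open>Lim\<close> is a choice operator, so existence of the limit has to be shown: for
  \<open>t \<ge> 0\<close> the function is nonincreasing and bounded below, hence tends to its
  infimum.\<close>

lemma busemann_tendsto:
  assumes c: "geodesic_ray c"
  shows "((\<lambda>t. dist x (c t) - t) \<longlongrightarrow> busemann c x) at_top"
proof -
  let ?f = "\<lambda>t. dist x (c t) - t"
  have iso: "dist (c s) (c t) = \<bar>s - t\<bar>" if "0 \<le> s" "0 \<le> t" for s t
    using c that unfolding geodesic_ray_def by blast
  have decr: "?f t \<le> ?f s" if "0 \<le> s" "s \<le> t" for s t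
    using iso[of s t] dist_triangle[of x "c t" "c s"] that by simp
  have bound: "- dist x (c 0) \<le> ?f t" if "0 \<le> t" for t
    using iso[of 0 t] dist_triangle3[of "c 0" "c t" x] that by simp
  have bdd: "bdd_below (?f ` {0..})" using bound by (intro bdd_belowI2) auto
  have "(?f \<longlongrightarrow> Inf (?f ` {0..})) at_top"
  proof (rule order_tendstoI)
    fix a assume a: "a < Inf (?f ` {0..})"
    have "a < ?f t" if "0 \<le> t" for t
      using a cINF_lower[OF bdd, of t] that by simp
    then show "\<forall>\<^sub>F t in at_top. a < ?f t"
      using eventually_ge_at_top[of 0] by (rule eventually_mono[rotated])
  next
    fix a assume "Inf (?f ` {0..}) < a"
    then obtain s where "0 \<le> s" "?f s < a" using cINF_less_iff[OF _ bdd] by auto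
    then have "?f t < a" if "s \<le> t" for t using decr[of s t] that by simp
    then show "\<forall>\<^sub>F t in at_top. ?f t < a"
      using eventually_ge_at_top[of s] by (rule eventually_mono[rotated])
  qed
  then show ?thesis unfolding busemann_def by (simp add: tendsto_Lim)
qed

lemma geodesic_ray_path:
  assumes "geodesic_ray c" "0 \<le> s" "s \<le> t"
  shows "geodesic_path (\<lambda>u. c (s + u)) (t - s) (c s) (c t)"
  using assms by (auto simp: geodesic_path_def geodesic_ray_def)

lemma geodesic_path_nearest:
  assumes "geodesic_path g l p q"
  obtains s where "s \<in> {0..l}" "\<And>t. t \<in> {0..l} \<Longrightarrow> dist (g s) y \<le> dist (g t) y"
proof -
  have "1-lipschitz_on {0..l} g"
    using assms by (intro lipschitz_onI) (auto simp: geodesic_path_def dist_real_def)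
  then have "continuous_on {0..l} (\<lambda>t. dist (g t) y)"
    by (intro continuous_intros lipschitz_on_continuous_on)
  moreover have "{0..l} \<noteq> {}" using assms by (simp add: geodesic_path_def)
  ultimately obtain s where "s \<in> {0..l}" "\<forall>t\<in>{0..l}. dist (g s) y \<le> dist (g t) y"
    using continuous_attains_inf[OF compact_Icc] by blast
  then show ?thesis using that by blast
qed

section \<open>Criteria for being asymptotic to a given ray\<close>

text \<open>The parameters \<open>t\<close> and \<open>w\<close> are distances to the two origins,
  so they differ by at most \<open>N + dist (\<xi> 0) (c 0)\<close>; closeness as sets thus becomes
  closeness at equal times.\<close>

lemma geodesic_ray_near_asymptotic:
  assumes \<xi>: "geodesic_ray \<xi>" and c: "geodesic_ray c"
    and near: "\<And>t. 0 \<le> t \<Longrightarrow> \<exists>w\<ge>0. dist (\<xi> t) (c w) \<le> N"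
  shows "(\<xi>, c) \<in> asymptotic_rel"
proof -
  have iso: "dist (\<xi> s) (\<xi> t) = \<bar>s - t\<bar>" "dist (c s) (c t) = \<bar>s - t\<bar>" if "0 \<le> s" "0 \<le> t" for s t
    using \<xi> c that unfolding geodesic_ray_def by blast+
  have "dist (\<xi> t) (c t) \<le> 2 * N + dist (\<xi> 0) (c 0)" if t: "0 \<le> t" for t
  proof -
    obtain w where w: "0 \<le> w" "dist (\<xi> t) (c w) \<le> N" using near t by blast
    have "dist (\<xi> 0) (\<xi> t) = t" "dist (c 0) (c w) = w" "dist (c w) (c t) = \<bar>w - t\<bar>"
      using iso t w by auto
    moreover have "dist (\<xi> 0) (\<xi> t) \<le> dist (\<xi> 0) (c 0) + dist (c 0) (c w) + dist (\<xi> t) (c w)"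
      "dist (c 0) (c w) \<le> dist (\<xi> 0) (c 0) + dist (\<xi> 0) (\<xi> t) + dist (\<xi> t) (c w)"
      "dist (\<xi> t) (c t) \<le> dist (\<xi> t) (c w) + dist (c w) (c t)"
      by metric+
    ultimately show ?thesis using w by linarith
  qed
  then show ?thesis using \<xi> c unfolding asymptotic_rel_def by blast
qed

text \<open>If \<open>\<xi>\<close> and \<open>c\<close> diverge, then \<open>c v\<close> projects to a bounded part of \<open>\<xi>\<close>, so the right angle
  there makes the distance from \<open>\<xi> t\<close> to \<open>c v\<close> much larger than \<open>v\<close>, for every \<open>v\<close> comparable to \<open>t\<close>.
  But a geodesic from \<open>c s\<close> (with \<open>s\<close> large) to \<open>\<xi> t\<close> meets a neighbourhood of some \<open>c v\<close> when it is
  closest to \<open>c 0\<close>, and the horoball condition bounds the distance from \<open>\<xi> t\<close> to this \<open>c v\<close>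
  by \<open>v\<close> plus a constant.\<close>

lemma Morse_ray_horoball_asymptotic:
  fixes c \<xi> :: "real \<Rightarrow> 'a::metric_space"
  assumes cat: "CAT0_space TYPE('a)" and c: "Morse_ray c" and \<xi>: "geodesic_ray \<xi>"
    and horo: "\<And>t. 0 \<le> t \<Longrightarrow> \<forall>\<^sub>F s in at_top. dist (\<xi> t) (c s) \<le> s + K"
  shows "(\<xi>, c) \<in> asymptotic_rel"
proof -
  define \<delta> where "\<delta> = dist (c 0) (\<xi> 0)"
  have \<delta>: "0 \<le> \<delta>" by (simp add: \<delta>_def)
  have geo: "geodesic_space TYPE('a)" using cat by (simp add: CAT0_space_def)
  have cray: "geodesic_ray c" using c by (simp add: Morse_ray_def)
  have iso: "dist (\<xi> s) (\<xi> t) = \<bar>s - t\<bar>" "dist (c s) (c t) = \<bar>s - t\<bar>" if "0 \<le> s" "0 \<le> t" for s t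
    using \<xi> cray that unfolding geodesic_ray_def by blast+
  \<comment> \<open>One \<open>N\<close> serves both uses: geodesics starting at
    \<open>\<xi> 0\<close>, at distance \<open>\<delta>\<close> from \<open>c 0\<close>, and
    geodesics starting on \<open>c\<close> itself.\<close>
  obtain N where N: "0 \<le> N"
    "\<And>g l p z u v t. \<lbrakk>geodesic_path g l p z; 0 \<le> u; dist (c u) p \<le> \<delta>; 0 \<le> v;
      \<And>s. s \<in> {0..l} \<Longrightarrow> dist z (c v) \<le> dist (g s) (c v); t \<in> {0..l}\<rbrakk>
      \<Longrightarrow> \<exists>w\<ge>0. dist (g t) (c w) \<le> N"
    using Morse_projection[OF geo c \<delta>] by blast
  define proj where "proj t v \<longleftrightarrow> (\<forall>s\<in>{0..t}. dist (\<xi> t) (c v) \<le> dist (\<xi> s) (c v))" for t v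
  show ?thesis
  proof (cases "\<forall>T. \<exists>t\<ge>T. \<exists>v\<ge>0. proj t v")
    case True
    have "\<exists>w\<ge>0. dist (\<xi> t) (c w) \<le> N" if t: "0 \<le> t" for t
    proof -
      \<comment> \<open>Arbitrarily long initial segments of \<open>\<xi>\<close> end at a
        projection of a point of \<open>c\<close>, so each of them stays \<open>N\<close>-close to
        \<open>c\<close>.\<close>
      obtain t' v where "t \<le> t'" "0 \<le> v" "proj t' v" using True by blast
      then show ?thesis
        using geodesic_ray_path[OF \<xi>, of 0 t'] t
        by (intro N(2)[of \<xi> t' "\<xi> 0" "\<xi> t'" 0 v]) (auto simp: proj_def \<delta>_def)
    qed
    then show ?thesis by (rule geodesic_ray_near_asymptotic[OF \<xi> cray])
  next
    case False
    then obtain T0 where T0: "\<And>t v. T0 \<le> t \<Longrightarrow> 0 \<le> v \<Longrightarrow> \<not> proj t v" by blast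
    \<comment> \<open>From here on, points of \<open>c\<close> project to initial segments of
      \<open>\<xi>\<close> only at times up to \<open>T\<close>.\<close>
    define T where "T = max T0 0"
    have T: "0 \<le> T" "\<And>t v. 0 \<le> v \<Longrightarrow> proj t v \<Longrightarrow> t \<le> T" using T0 unfolding T_def by (simp, meson max.coboundedI1 nle_le)
    \<comment> \<open>\<open>A\<close> is the error in the estimate of
      \<open>dist (\<xi> t) (c v)\<close> by \<open>v\<close>. \<open>D\<close> dominates all
      constants, and \<open>t = 20 * D\<close> is large enough for the final numerical
      contradiction.\<close>
    define A where "A = \<bar>K\<bar> + 2 * N"
    define D where "D = A + \<delta> + T + N + 1"
    have A: "0 \<le> A" using N by (simp add: A_def)
    have D: "1 \<le> D" using A \<delta> N(1) T(1) by (simp add: D_def)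
    define t where "t = 20 * D"
    have t: "0 \<le> t" "T \<le> t" using A D \<delta> N T by (auto simp: t_def D_def)
    obtain s where s: "0 \<le> s" "dist (\<xi> t) (c s) \<le> s + K"
      using eventually_happens'[OF _ eventually_conj[OF eventually_ge_at_top[of 0] horo[OF t(1)]]]
      by auto
    obtain v where v: "0 \<le> v" "v \<le> t + \<delta> + N" "dist (\<xi> t) (c v) \<le> v + A"
    proof -
      obtain g l where g: "geodesic_path g l (c s) (\<xi> t)"
        using geo unfolding geodesic_space_def geodesic_segment_def by blast
      obtain b where b: "b \<in> {0..l}" "\<And>t. t \<in> {0..l} \<Longrightarrow> dist (g b) (c 0) \<le> dist (g t) (c 0)"
        using geodesic_path_nearest[OF g] by blast
      \<comment> \<open>Cut at its point nearest to \<open>c 0\<close>, the geodesic satisfies the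
        hypotheses of \<open>N\<close> with target \<open>c 0\<close>.\<close>
      have gb: "geodesic_path g b (c s) (g b)" using g b by (auto simp: geodesic_path_def)
      have "\<exists>v\<ge>0. dist (g b) (c v) \<le> N"
        using b by (intro N(2)[OF gb s(1) _ order_refl]) (auto simp: \<delta>)
      then obtain v where v: "0 \<le> v" "dist (g b) (c v) \<le> N" by blast
      have isog: "dist (g x) (g y) = \<bar>x - y\<bar>" if "x \<in> {0..l}" "y \<in> {0..l}" for x y
        using g that by (simp add: geodesic_path_def)
      have gl: "g 0 = c s" "g l = \<xi> t" "0 \<le> l" using g by (auto simp: geodesic_path_def)
      have d1: "dist (c s) (g b) = b" "dist (g b) (\<xi> t) = l - b" "dist (c s) (\<xi> t) = l"
        using isog[of 0 b] isog[of b l] isog[of 0 l] b(1) gl by auto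
      \<comment> \<open>Comparison with the endpoint \<open>\<xi> t\<close> bounds \<open>v\<close>
        from above in terms of \<open>t\<close>.\<close>
      have "dist (g b) (c 0) \<le> dist (\<xi> t) (c 0)" using b(2)[of l] gl by auto
      moreover have "dist (\<xi> 0) (\<xi> t) = t" "dist (c 0) (c v) = v" using iso t v by auto
      moreover have "dist (\<xi> t) (c 0) \<le> dist (\<xi> 0) (\<xi> t) + \<delta>"
        "dist (c 0) (c v) \<le> dist (g b) (c 0) + dist (g b) (c v)"
        unfolding \<delta>_def by metric+
      ultimately have 1: "v \<le> t + \<delta> + N" using v(2) by linarith
      have "dist (c s) (c v) = \<bar>s - v\<bar>" using iso s v by auto
      moreover have "dist (c s) (c v) \<le> dist (c s) (g b) + dist (g b) (c v)"
        "dist (\<xi> t) (c v) \<le> dist (g b) (\<xi> t) + dist (g b) (c v)" by metric+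
      ultimately have "dist (\<xi> t) (c v) \<le> v + A"
        using d1 s(2) v(2) unfolding A_def by (simp add: dist_commute)
      with v 1 show ?thesis using that by blast
    qed
    obtain t' where t': "t' \<in> {0..t}" "\<And>s. s \<in> {0..t} \<Longrightarrow> dist (\<xi> t') (c v) \<le> dist (\<xi> s) (c v)"
      using geodesic_path_nearest[OF geodesic_ray_path[OF \<xi> order_refl t(1)], of "c v"] by auto
    then have "proj t' v" by (auto simp: proj_def)
    then have t'T: "t' \<le> T" using T v by blast
    have path: "geodesic_path (\<lambda>u. \<xi> (t' + u)) (t - t') (\<xi> t') (\<xi> t)"
      using t' by (intro geodesic_ray_path[OF \<xi>]) auto
    have right_angle: "(dist (\<xi> t') (c v))\<^sup>2 + (t - t')\<^sup>2 / 2 \<le> (dist (\<xi> t) (c v))\<^sup>2"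
      using t' by (intro CAT0_projection[OF cat path]) auto
    have "dist (\<xi> 0) (\<xi> t) = t" "dist (\<xi> 0) (\<xi> t') = t'" "dist (c 0) (c v) = v"
      using iso[of 0 t] iso[of 0 t'] iso[of 0 v] t t' v by auto
    moreover have "dist (\<xi> 0) (\<xi> t) \<le> \<delta> + dist (c 0) (c v) + dist (\<xi> t) (c v)"
      "dist (c 0) (c v) \<le> \<delta> + dist (\<xi> 0) (\<xi> t') + dist (\<xi> t') (c v)"
      unfolding \<delta>_def by metric+
    ultimately have tv: "t \<le> 2 * v + \<delta> + A" and vd: "v - (\<delta> + T) \<le> dist (\<xi> t') (c v)"
      using v t'T by linarith+
    have vB: "0 \<le> v - (\<delta> + T)"
      using tv D A \<delta> N(1) T(1) unfolding t_def D_def by (simp add: algebra_simps)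
    have "(v - (\<delta> + T))\<^sup>2 \<le> (dist (\<xi> t') (c v))\<^sup>2" using vd vB by (intro power_mono)
    moreover have "(19 * D)\<^sup>2 \<le> (t - t')\<^sup>2"
      using t'T D A \<delta> N(1) T(1) unfolding t_def D_def by (intro power_mono) auto
    moreover have "(dist (\<xi> t) (c v))\<^sup>2 \<le> (v + A)\<^sup>2" using v by (intro power_mono) auto
    moreover have "(v + A)\<^sup>2 - (v - (\<delta> + T))\<^sup>2 \<le> 43 * D\<^sup>2"
    proof -
      have "(v + A)\<^sup>2 - (v - (\<delta> + T))\<^sup>2 = (A + \<delta> + T) * (2 * v + A - (\<delta> + T))"
        by (simp add: power2_eq_square algebra_simps)
      \<comment> \<open>The first factor is at most \<open>D\<close>. By
        \<open>v \<le> t + \<delta> + N\<close> the second is at most \<open>40 * D\<close> plus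
        terms bounded by \<open>3 * D\<close>.\<close>
      also have "\<dots> \<le> D * (43 * D)"
        using v vB D A \<delta> N(1) T(1) unfolding t_def by (intro mult_mono) (auto simp: D_def)
      finally show ?thesis by (simp add: power2_eq_square)
    qed
    \<comment> \<open>Clearing the factor 1/2 doubles 43 to 86, while the square of 19 is 361; this
      is absurd for \<open>D \<ge> 1\<close>.\<close>
    ultimately have "(19 * D)\<^sup>2 \<le> 86 * D\<^sup>2" using right_angle by linarith
    then have "D\<^sup>2 \<le> 0" by (simp add: power_mult_distrib)
    then show ?thesis using D by simp
  qed
qed

section \<open>Limits of points in a sublevel set, and the conclusion\<close>

text \<open>Geodesics from \<open>\<xi> 0\<close> to suitable \<open>x n\<close> pass close to
  \<open>\<xi> t\<close> at time \<open>t\<close>. Convexity bounds \<open>h\<close> there by its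
  endpoint values, and continuity carries the bound over to \<open>\<xi> t\<close>. One good index
  for each \<open>e\<close> is enough, so a frequent bound suffices.\<close>

lemma sublevel_limit_ray:
  assumes conv: "geodesically_convex h" and cont: "continuous_on UNIV h"
    and \<eta>: "\<eta> \<in> visual_boundary" "\<xi> \<in> \<eta>"
    and lim: "limitin cone_topology (\<lambda>n. Inl (x n)) (Inr \<eta>) sequentially"
    and freq: "\<exists>\<^sub>F n in sequentially. h (x n) \<le> M" and t: "0 < t"
  shows "h (\<xi> t) \<le> max (h (\<xi> 0)) M"
proof (rule field_le_epsilon)
  fix e :: real assume "0 < e"
  then obtain d where d: "0 < d" "\<And>y. dist y (\<xi> t) < d \<Longrightarrow> dist (h y) (h (\<xi> t)) < e"
    using cont unfolding continuous_on_iff by (metis UNIV_I)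
  have ray: "geodesic_ray \<xi>" using \<eta> by (rule visual_boundary_rayD)
  have "openin cone_topology (cone_nbhd \<xi> t d)"
    unfolding cone_topology_def using ray t d by (intro topology_generated_by_Basis) blast
  moreover have "Inr \<eta> \<in> cone_nbhd \<xi> t d"
    using \<eta> d(1) unfolding cone_nbhd_def by force
  ultimately have "\<forall>\<^sub>F n in sequentially. Inl (x n) \<in> cone_nbhd \<xi> t d"
    using lim by (auto simp: limitin_def)
  then have "\<exists>\<^sub>F n in sequentially. h (x n) \<le> M \<and> Inl (x n) \<in> cone_nbhd \<xi> t d"
    using freq by (rule frequently_eventually_frequently[rotated])
  then obtain n where n: "h (x n) \<le> M" "Inl (x n) \<in> cone_nbhd \<xi> t d"
    using frequently_ex by blast
  let ?L = "dist (\<xi> 0) (x n)"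
  from n(2) obtain g where g: "geodesic_path g ?L (\<xi> 0) (x n)" "dist (g t) (\<xi> t) < d"
    and L: "t < ?L"
    unfolding cone_nbhd_def by auto
  have "convex_on {0..?L} (\<lambda>s. h (g s))" using conv g(1) unfolding geodesically_convex_def by blast
  then have "h (g t) \<le> max (h (g 0)) (h (g ?L))"
    by (rule convex_on_le_max) (use L t in auto)
  then have "h (g t) \<le> max (h (\<xi> 0)) M" using g(1) n(1) by (auto simp: geodesic_path_def)
  moreover have "h (\<xi> t) < h (g t) + e" using d(2)[OF g(2)] by (simp add: dist_real_def)
  ultimately show "h (\<xi> t) \<le> max (h (\<xi> 0)) M + e" by linarith
qed

theorem theorem6p14:
  fixes h :: "'a::complete_space \<Rightarrow> real"
    and \<zeta> :: "(real \<Rightarrow> 'a) set"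
    and r :: "nat \<Rightarrow> real"
  assumes "proper_space TYPE('a)"
    and "CAT0_space TYPE('a)"
    and "\<zeta> \<in> Morse_boundary"
    and "horofunction h"
    and "corresponds_to h \<zeta>"
    and "\<not> filterlim r at_bot sequentially"
  shows "horospheres_converge (\<lambda>n. horosphere h (r n)) \<zeta>"
  unfolding horospheres_converge_def
proof (intro allI ballI impI)
  fix x :: "nat \<Rightarrow> 'a" and \<eta> :: "(real \<Rightarrow> 'a) set"
  assume \<eta>: "\<eta> \<in> visual_boundary"
    and x: "(\<forall>n. x n \<in> horosphere h (r n)) \<and>
      limitin cone_topology (\<lambda>n. Inl (x n)) (Inr \<eta>) sequentially"
  obtain c where \<zeta>: "\<zeta> \<in> visual_boundary" and c: "c \<in> \<zeta>" "Morse_ray c"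
    using assms(3) by (auto simp: Morse_boundary_def)
  obtain b C where b: "b \<in> \<zeta>" "geodesic_ray b" and h: "\<And>x. h x = busemann b x + C"
    using assms(5) unfolding corresponds_to_def by blast
  \<comment> \<open>The ray defining \<open>h\<close> need not be the Morse ray, but the two stay
    within \<open>B\<close> of each other.\<close>
  obtain B where B: "\<And>t. 0 \<le> t \<Longrightarrow> dist (b t) (c t) \<le> B"
    using visual_boundary_asymptotic[OF \<zeta> b(1) c(1)] by (auto simp: asymptotic_rel_def)
  obtain \<xi> where \<xi>: "\<xi> \<in> \<eta>"
    using \<eta> in_quotient_imp_non_empty[OF equiv_asymptotic_rel] unfolding visual_boundary_def by blast
  \<comment> \<open>Some \<open>Z\<close> is exceeded by \<open>r n\<close> infinitely often; as
    \<open>horosphere h (r n)\<close> is the level set of \<open>- r n\<close>, there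
    \<open>h (x n) \<le> - Z\<close>.\<close>
  obtain Z where "\<not> (\<forall>\<^sub>F n in sequentially. r n \<le> Z)"
    using assms(6) by (auto simp: filterlim_at_bot)
  then have "\<exists>\<^sub>F n in sequentially. \<not> r n \<le> Z" by (simp add: not_eventually)
  then have freq: "\<exists>\<^sub>F n in sequentially. h (x n) \<le> - Z"
    by (rule frequently_elim1) (use x in \<open>auto simp: horosphere_def\<close>)
  define M where "M = max (h (\<xi> 0)) (- Z)"
  have hM: "h (\<xi> t) \<le> M" if "0 \<le> t" for t
  \<comment> \<open>Cone neighbourhoods have positive radius, so \<open>t = 0\<close> is separate;
    \<open>M\<close> includes \<open>h (\<xi> 0)\<close> for it.\<close>
  proof (cases "t = 0")
    case False
    then show ?thesis
      using sublevel_limit_ray[OF _ _ \<eta> \<xi> conjunct2[OF x] freq] assms(4) that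
      by (simp add: M_def horofunction_def distance_like_def)
  qed (simp add: M_def)
  \<comment> \<open>In the constant, \<open>M - C\<close> bounds the Busemann function along
    \<open>\<xi>\<close>, 1 leaves room for passing from the limit to large \<open>s\<close>, and
    \<open>B\<close> replaces \<open>b\<close> by \<open>c\<close>.\<close>
  have "\<forall>\<^sub>F s in at_top. dist (\<xi> t) (c s) \<le> s + (M - C + 1 + B)" if "0 \<le> t" for t
  proof -
    have "busemann b (\<xi> t) < M - C + 1" using hM[OF that] h[of "\<xi> t"] by linarith
    then have "\<forall>\<^sub>F s in at_top. dist (\<xi> t) (b s) - s < M - C + 1"
      by (rule order_tendstoD(2)[OF busemann_tendsto[OF b(2)]])
    then show ?thesis
      using eventually_ge_at_top[of 0]
    proof eventually_elim
      case (elim s)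
      then show ?case using B[of s] dist_triangle[of "\<xi> t" "c s" "b s"] by linarith
    qed
  qed
  then have "(\<xi>, c) \<in> asymptotic_rel"
    by (rule Morse_ray_horoball_asymptotic[OF assms(2) c(2) visual_boundary_rayD[OF \<eta> \<xi>]])
  then show "\<eta> = \<zeta>" by (rule visual_boundary_eqI[OF \<eta> \<zeta> \<xi> c(1)])
qed

end
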